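(* Let $K_n$ be the complete graph with $n$ vertices, where $n\geq 2$. Then \[P_{K_n}^{\times}(z)=\begin{cases} z^{n}+\sum_{i=1}^{n}\binom{n}{n+1-i}z^{i}, & \text{if } n \text{ is even},\\[2pt] z^{n-1}+\sum_{i=1}^{n}\binom{n}{n+1-i}z^{i}, & \text{if } n \text{ is odd}.\end{cases}\]
   Context: A ribbon graph $G$ is a surface with boundary formed from vertex discs and edge discs (ribbons), each edge attached to vertex discs along two disjoint arcs; $v,e,f,c$ denote numbers of vertices, edges, boundary components and connected components, and the Euler genus is $\varepsilon=2c-v+e-f$. For $A\subseteq E(G)$, the partial Petrial $G^{\times|A}$ is obtained by adding a half-twist to each edge in $A$, and ${^\partial\varepsilon^{\times}_{G}(z)}=\sum_{A\subseteq E(G)} z^{\varepsilon(G^{\times|A})}$. A bouquet is a ribbon graph with one vertex; two loops are interlaced if their ends alternate around the vertex boundary; the intersection graph $I(B)$ has vertex set $E(B)$ with adjacency meaning interlaced. A circle graph is a graph $I(B)$ for some bouquet $B$, and for a circle graph $G$, $P_G^{\times}(z):={^\partial\varepsilon^{\times}_{B}(z)}$ for any bouquet $B$ with $I(B)=G$ (independent of the choice of $B$). *)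

theory Defs
  imports "Graph_Theory.Graph_Theory" "HOL-Computational_Algebra.Polynomial"
begin

text \<open>
  Ribbon graphs are represented up to homeomorphism by their flags. A flag is a corner of an edge
  ribbon, that is, an end point of one of the two arcs along which the ribbon is attached to vertex
  discs. Every flag is the end point of exactly three arcs, and passing to the other end point of
  such an arc gives three involutions on the flags:

  \<^item> \<open>foot\<close>: the arc along which the ribbon is attached to the vertex disc;
  \<^item> \<open>side\<close>: the free side of the ribbon;
  \<^item> \<open>gap\<close>: the free arc of the boundary of the vertex disc, leading to the neighbouring ribbon end.

  A vertex disc with no ribbon attached has no flags; \<open>isolated\<close> is the number of these.
\<close>

record 'f ribbon_graph =
  flags :: "'f set"
  foot :: "'f \<Rightarrow> 'f"
  side :: "'f \<Rightarrow> 'f"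
  gap :: "'f \<Rightarrow> 'f"
  isolated :: nat

definition fixfree_involution_on :: "'f set \<Rightarrow> ('f \<Rightarrow> 'f) \<Rightarrow> bool" where
  "fixfree_involution_on Q \<phi> \<longleftrightarrow> (\<forall>x\<in>Q. \<phi> x \<in> Q \<and> \<phi> x \<noteq> x \<and> \<phi> (\<phi> x) = x)"

text \<open>The last condition says that the four corners \<open>x\<close>, \<open>foot x\<close>, \<open>side x\<close>, \<open>foot (side x)\<close> of a
  ribbon are distinct and that \<open>foot\<close> and \<open>side\<close> run around its boundary, a quadrilateral.\<close>

definition is_ribbon_graph :: "'f ribbon_graph \<Rightarrow> bool" where
  "is_ribbon_graph G \<longleftrightarrow>
     finite (flags G) \<and>
     fixfree_involution_on (flags G) (foot G) \<and>
     fixfree_involution_on (flags G) (side G) \<and>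
     fixfree_involution_on (flags G) (gap G) \<and>
     (\<forall>x\<in>flags G. foot G (side G x) = side G (foot G x) \<and> foot G x \<noteq> side G x)"

definition orbits :: "'f set \<Rightarrow> ('f \<Rightarrow> 'f) set \<Rightarrow> 'f set set" where
  "orbits Q F = Q // {(x, y). x \<in> Q \<and> (x, y) \<in> {(u, \<phi> u) |u \<phi>. u \<in> Q \<and> \<phi> \<in> F}\<^sup>*}"

text \<open>An edge is identified with the set of its four corners.\<close>

definition edges :: "'f ribbon_graph \<Rightarrow> 'f set set" where
  "edges G = orbits (flags G) {foot G, side G}"

definition num_vertices :: "'f ribbon_graph \<Rightarrow> nat" where
  "num_vertices G = card (orbits (flags G) {foot G, gap G}) + isolated G"

definition num_edges :: "'f ribbon_graph \<Rightarrow> nat" where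
  "num_edges G = card (edges G)"

text \<open>The boundary of the surface consists of the free sides of the ribbons, the free arcs of the
  vertex discs, and the boundary circles of the isolated vertex discs.\<close>

definition num_boundary_components :: "'f ribbon_graph \<Rightarrow> nat" where
  "num_boundary_components G = card (orbits (flags G) {side G, gap G}) + isolated G"

definition num_components :: "'f ribbon_graph \<Rightarrow> nat" where
  "num_components G = card (orbits (flags G) {foot G, side G, gap G}) + isolated G"

definition euler_genus :: "'f ribbon_graph \<Rightarrow> int" where
  "euler_genus G = 2 * int (num_components G) - int (num_vertices G) + int (num_edges G)
     - int (num_boundary_components G)"

text \<open>A half-twist of a ribbon exchanges the two corners at one of its ends, so that each side of the
  ribbon now joins corners that were diagonally opposite.\<close>

definition partial_petrial :: "'f ribbon_graph \<Rightarrow> 'f set set \<Rightarrow> 'f ribbon_graph" where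
  "partial_petrial G A =
     G\<lparr>side := (\<lambda>x. if x \<in> \<Union>A then side G (foot G x) else side G x)\<rparr>"

text \<open>The Euler genus of a ribbon graph is nonnegative, so \<open>nat\<close> does not truncate here.\<close>

definition petrial_poly :: "'f ribbon_graph \<Rightarrow> int poly" where
  "petrial_poly G = (\<Sum>A\<in>Pow (edges G). monom 1 (nat (euler_genus (partial_petrial G A))))"

definition bouquet :: "'f ribbon_graph \<Rightarrow> bool" where
  "bouquet B \<longleftrightarrow> is_ribbon_graph B \<and> num_vertices B = 1"

text \<open>Starting at a flag \<open>x\<close>, crossing the foot of its ribbon end and then the following gap leads to
  the next ribbon end around the vertex; iterating this meets every end at the vertex exactly once
  before returning to \<open>x\<close>. Injectivity on \<open>{..k}\<close> says that \<open>k\<close> steps stay within a single turn.\<close>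

definition next_end :: "'f ribbon_graph \<Rightarrow> 'f \<Rightarrow> 'f" where
  "next_end G x = gap G (foot G x)"

definition interlaced :: "'f ribbon_graph \<Rightarrow> 'f set \<Rightarrow> 'f set \<Rightarrow> bool" where
  "interlaced B e f \<longleftrightarrow> e \<noteq> f \<and>
     (\<exists>x\<in>e. \<exists>i j k. 0 < i \<and> i < j \<and> j < k \<and>
        inj_on (\<lambda>m. (next_end B ^^ m) x) {..k} \<and>
        (next_end B ^^ i) x \<in> f \<and> (next_end B ^^ j) x \<in> e \<and> (next_end B ^^ k) x \<in> f)"

definition intersection_graph :: "'f ribbon_graph \<Rightarrow> 'f set pair_pre_digraph" where
  "intersection_graph B =
     \<lparr>pverts = edges B, parcs = {(e, f). e \<in> edges B \<and> f \<in> edges B \<and> interlaced B e f}\<rparr>"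

text \<open>The common polynomial of all bouquets with intersection graph \<open>G\<close> (up to isomorphism). It is
  unspecified unless such a bouquet exists and all of them have the same polynomial. Since the set of
  flags is finite, taking flags of type \<open>nat\<close> is no restriction on the bouquets.\<close>

definition circle_graph_petrial_poly :: "('a, 'b) pre_digraph \<Rightarrow> int poly" where
  "circle_graph_petrial_poly G =
     (THE p. (\<exists>B :: nat ribbon_graph. bouquet B \<and> digraph_iso (with_proj (intersection_graph B)) G) \<and>
        (\<forall>B :: nat ribbon_graph. bouquet B \<and> digraph_iso (with_proj (intersection_graph B)) G
            \<longrightarrow> petrial_poly B = p))"

end

theory Submission
  imports Defs
begin

text \<open>Number the ribbon ends of a bouquet in their cyclic order around the vertex. All loops are
  pairwise interlaced iff end \<open>m\<close> always belongs to the same ribbon as end \<open>m + n\<close> modulo \<open>2 * n\<close>, so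
  such a bouquet is determined by the set of its twisted ribbons, and partial Petrials reach every
  such set exactly once. If \<open>k > 0\<close> ribbons are twisted, then the twisted ribbons cut the cyclic
  sequence of the \<open>n\<close> ribbons into \<open>k\<close> blocks, and each block carries exactly one boundary component.
  If no ribbon is twisted, then the boundary walk advances by \<open>n + 1\<close> among the \<open>2 * n\<close> gaps and so has
  \<open>gcd (n + 1) (2 * n)\<close> cycles. Hence the Euler genus is \<open>n + 1 - k\<close> in the first case, and \<open>n\<close> or
  \<open>n - 1\<close> in the second case.\<close>

section \<open>Orbits of involutions\<close>

definition reach :: "'f set \<Rightarrow> ('f \<Rightarrow> 'f) set \<Rightarrow> 'f \<Rightarrow> 'f \<Rightarrow> bool" where
  "reach Q F x y \<longleftrightarrow> (x, y) \<in> {(u, \<phi> u) |u \<phi>. u \<in> Q \<and> \<phi> \<in> F}\<^sup>*"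

lemma orbits_reach: "orbits Q F = Q // {(x, y). x \<in> Q \<and> reach Q F x y}"
  by (simp add: orbits_def reach_def)

lemma reach_refl [simp]: "reach Q F x x"
  by (simp add: reach_def)

lemma reach_trans [trans]: "reach Q F x y \<Longrightarrow> reach Q F y z \<Longrightarrow> reach Q F x z"
  unfolding reach_def by (rule rtrancl_trans)

lemma reach_step: "x \<in> Q \<Longrightarrow> \<phi> \<in> F \<Longrightarrow> reach Q F x (\<phi> x)"
  unfolding reach_def by (rule r_into_rtrancl) blast

lemma reach_mono:
  assumes "reach Q F x y" "F \<subseteq> F'"
  shows "reach Q F' x y"
proof -
  have "{(u, \<phi> u) |u \<phi>. u \<in> Q \<and> \<phi> \<in> F} \<subseteq> {(u, \<phi> u) |u \<phi>. u \<in> Q \<and> \<phi> \<in> F'}"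
    using assms(2) by blast
  then show ?thesis
    using assms(1) rtrancl_mono unfolding reach_def by blast
qed

lemma reach_induct [consumes 1, case_names refl step]:
  assumes "reach Q F x y" "P x"
    and "\<And>u \<phi>. reach Q F x u \<Longrightarrow> u \<in> Q \<Longrightarrow> \<phi> \<in> F \<Longrightarrow> P u \<Longrightarrow> P (\<phi> u)"
  shows "P y"
  using assms(1) unfolding reach_def
proof (induction rule: rtrancl_induct)
  case base
  then show ?case using assms(2) .
next
  case (step y z)
  then show ?case using assms(3) unfolding reach_def by blast
qed

lemma reach_sym:
  assumes "reach Q F x y" "\<And>\<phi>. \<phi> \<in> F \<Longrightarrow> fixfree_involution_on Q \<phi>"
  shows "reach Q F y x"
  using assms(1)
proof (induction rule: reach_induct)
  case (step u \<phi>)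
  then have "\<phi> u \<in> Q" "\<phi> (\<phi> u) = u"
    using assms(2) by (auto simp: fixfree_involution_on_def)
  then have "reach Q F (\<phi> u) u"
    using reach_step[of "\<phi> u" Q \<phi> F] step by simp
  then show ?case using step reach_trans by metis
qed simp

text \<open>A function \<open>h\<close> that is constant along steps and has connected fibres is a
  complete orbit invariant. Edges and boundary components are found in this way, with
  \<open>edge_of\<close> and a label of gaps as \<open>h\<close>.\<close>

lemma orbits_eq_fibres:
  assumes inv: "\<And>x \<phi>. x \<in> Q \<Longrightarrow> \<phi> \<in> F \<Longrightarrow> \<phi> x \<in> Q \<and> h (\<phi> x) = h x"
    and conn: "\<And>x y. x \<in> Q \<Longrightarrow> y \<in> Q \<Longrightarrow> h x = h y \<Longrightarrow> reach Q F x y"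
  shows "orbits Q F = (\<lambda>c. {x \<in> Q. h x = c}) ` h ` Q"
proof -
  have *: "y \<in> Q \<and> h y = h x" if "reach Q F x y" "x \<in> Q" for x y
    using that by (induction rule: reach_induct) (use inv in auto)
  have "{(x, y). x \<in> Q \<and> reach Q F x y} `` {x} = {y \<in> Q. h y = h x}" if "x \<in> Q" for x
  proof (intro set_eqI iffI)
    fix y assume "y \<in> {(x, y). x \<in> Q \<and> reach Q F x y} `` {x}"
    then show "y \<in> {y \<in> Q. h y = h x}"
      using *[of x y] by simp
  next
    fix y assume "y \<in> {y \<in> Q. h y = h x}"
    then show "y \<in> {(x, y). x \<in> Q \<and> reach Q F x y} `` {x}"
      using conn[of x y] that by simp
  qed
  then show ?thesis
    unfolding orbits_reach quotient_def by auto
qed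

lemma card_orbits:
  assumes "\<And>x \<phi>. x \<in> Q \<Longrightarrow> \<phi> \<in> F \<Longrightarrow> \<phi> x \<in> Q \<and> h (\<phi> x) = h x"
    and "\<And>x y. x \<in> Q \<Longrightarrow> y \<in> Q \<Longrightarrow> h x = h y \<Longrightarrow> reach Q F x y"
  shows "card (orbits Q F) = card (h ` Q)"
proof -
  have "inj_on (\<lambda>c. {x \<in> Q. h x = c}) (h ` Q)"
    by (rule inj_onI) blast
  moreover have "orbits Q F = (\<lambda>c. {x \<in> Q. h x = c}) ` h ` Q"
    by (rule orbits_eq_fibres) (use assms in blast)+
  ultimately show ?thesis
    by (simp add: card_image)
qed

lemma card_orbits_transitive:
  assumes "Q \<noteq> {}" "\<And>x \<phi>. x \<in> Q \<Longrightarrow> \<phi> \<in> F \<Longrightarrow> \<phi> x \<in> Q"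
    and "\<And>x y. x \<in> Q \<Longrightarrow> y \<in> Q \<Longrightarrow> reach Q F x y"
  shows "card (orbits Q F) = 1"
proof -
  have "card (orbits Q F) = card ((\<lambda>_. 0 :: nat) ` Q)"
    by (rule card_orbits) (use assms in blast)+
  then show ?thesis
    using assms(1) by (simp add: image_constant_conv)
qed

lemma reach_if_one_orbit:
  assumes "card (orbits Q F) = 1" "x \<in> Q" "y \<in> Q"
  shows "reach Q F x y"
proof -
  let ?R = "{(x, y). x \<in> Q \<and> reach Q F x y}"
  obtain C where C: "Q // ?R = {C}"
    using assms(1) by (auto simp: orbits_reach card_1_singleton_iff)
  have "?R `` {x} \<in> Q // ?R" "?R `` {y} \<in> Q // ?R"
    using quotientI[of _ Q ?R] assms(2,3) by blast+
  then have "?R `` {x} = ?R `` {y}"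
    using C by simp
  moreover have "y \<in> ?R `` {y}"
    using assms by simp
  ultimately show ?thesis by auto
qed

section \<open>Ribbon graphs\<close>

text \<open>Since \<open>foot\<close> and \<open>side\<close> are commuting involutions on the flags
  of a ribbon graph, these four corners already form the whole orbit.\<close>

definition edge_of :: "'f ribbon_graph \<Rightarrow> 'f \<Rightarrow> 'f set" where
  "edge_of G x = {x, foot G x, side G x, foot G (side G x)}"

locale ribbon =
  fixes B :: "'f ribbon_graph"
  assumes ribbon: "is_ribbon_graph B"
begin

lemma finite_flags: "finite (flags B)"
  using ribbon by (simp add: is_ribbon_graph_def)

lemma involutions:
  "fixfree_involution_on (flags B) (foot B)"
  "fixfree_involution_on (flags B) (side B)"
  "fixfree_involution_on (flags B) (gap B)"
  using ribbon by (simp_all add: is_ribbon_graph_def)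

lemma foot [simp]:
  "x \<in> flags B \<Longrightarrow> foot B x \<in> flags B" "x \<in> flags B \<Longrightarrow> foot B x \<noteq> x"
  "x \<in> flags B \<Longrightarrow> foot B (foot B x) = x"
  using involutions(1) by (auto simp: fixfree_involution_on_def)

lemma side [simp]:
  "x \<in> flags B \<Longrightarrow> side B x \<in> flags B" "x \<in> flags B \<Longrightarrow> side B x \<noteq> x"
  "x \<in> flags B \<Longrightarrow> side B (side B x) = x"
  using involutions(2) by (auto simp: fixfree_involution_on_def)

lemma gap [simp]:
  "x \<in> flags B \<Longrightarrow> gap B x \<in> flags B" "x \<in> flags B \<Longrightarrow> gap B x \<noteq> x"
  "x \<in> flags B \<Longrightarrow> gap B (gap B x) = x"
  using involutions(3) by (auto simp: fixfree_involution_on_def)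

lemma side_foot: "x \<in> flags B \<Longrightarrow> side B (foot B x) = foot B (side B x)"
  and foot_ne_side: "x \<in> flags B \<Longrightarrow> foot B x \<noteq> side B x"
  using ribbon by (simp_all add: is_ribbon_graph_def)

lemma edge_of_foot: "x \<in> flags B \<Longrightarrow> edge_of B (foot B x) = edge_of B x"
  and edge_of_side: "x \<in> flags B \<Longrightarrow> edge_of B (side B x) = edge_of B x"
  by (auto simp: edge_of_def side_foot)

lemma edge_of_subset: "x \<in> flags B \<Longrightarrow> edge_of B x \<subseteq> flags B"
  by (auto simp: edge_of_def)

lemma mem_edge_of_iff:
  assumes "x \<in> flags B" "y \<in> flags B"
  shows "y \<in> edge_of B x \<longleftrightarrow> edge_of B y = edge_of B x"
proof
  assume "y \<in> edge_of B x"
  then show "edge_of B y = edge_of B x"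
    using assms edge_of_foot edge_of_side side(1) by (auto simp: edge_of_def[of B x])
next
  assume "edge_of B y = edge_of B x"
  then show "y \<in> edge_of B x"
    by (auto simp: edge_of_def)
qed

lemma edges_eq: "edges B = edge_of B ` flags B"
proof -
  have "reach (flags B) {foot B, side B} x y"
    if "x \<in> flags B" "y \<in> flags B" "edge_of B x = edge_of B y" for x y
  proof -
    have "y \<in> edge_of B x"
      using that by (simp add: mem_edge_of_iff)
    moreover have "reach (flags B) {foot B, side B} x (foot B x)"
      "reach (flags B) {foot B, side B} x (side B x)"
      "reach (flags B) {foot B, side B} (side B x) (foot B (side B x))"
      using that by (auto intro!: reach_step)
    ultimately show ?thesis
      unfolding edge_of_def using reach_trans by fastforce
  qed
  then have "edges B = (\<lambda>c. {x \<in> flags B. edge_of B x = c}) ` edge_of B ` flags B"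
    unfolding edges_def
    by (intro orbits_eq_fibres) (auto simp: edge_of_foot edge_of_side)
  also have "\<dots> = edge_of B ` flags B"
    unfolding image_image
  proof (rule image_cong[OF refl])
    fix z assume "z \<in> flags B"
    then show "{x \<in> flags B. edge_of B x = edge_of B z} = edge_of B z"
      using edge_of_subset mem_edge_of_iff by blast
  qed
  finally show ?thesis .
qed

lemma foot_mem_edge:
  assumes "x \<in> flags B" "f \<in> edges B"
  shows "foot B x \<in> f \<longleftrightarrow> x \<in> f"
  using assms by (auto simp: edges_eq mem_edge_of_iff edge_of_foot)

lemma edge_eqI:
  assumes "f \<in> edges B" "x \<in> f"
  shows "f = edge_of B x" "x \<in> flags B"
proof -
  obtain z where z: "z \<in> flags B" "f = edge_of B z"
    using assms by (auto simp: edges_eq)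
  then show "x \<in> flags B"
    using assms edge_of_subset by blast
  then show "f = edge_of B x"
    using assms z mem_edge_of_iff by simp
qed

end

section \<open>Bouquets with antipodal ribbon ends\<close>

text \<open>End \<open>m\<close> has the corners \<open>X m\<close> and \<open>Y m\<close>, in the order in which they are met around the vertex;
  \<open>\<tau> m\<close> says that its ribbon is twisted. Indices count modulo \<open>2 * n\<close>.\<close>

locale antipodal =
  fixes B :: "'f ribbon_graph" and n :: nat and X Y :: "nat \<Rightarrow> 'f" and \<tau> :: "nat \<Rightarrow> bool"
  assumes n_pos: "n > 0"
    and flags_eq: "flags B = range X \<union> range Y"
    and isolated_eq: "isolated B = 0"
    and X_eq_iff: "X a = X b \<longleftrightarrow> a mod (2 * n) = b mod (2 * n)"
    and Y_eq_iff: "Y a = Y b \<longleftrightarrow> a mod (2 * n) = b mod (2 * n)"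
    and X_ne_Y: "X a \<noteq> Y b"
    and foot_X: "foot B (X m) = Y m"
    and foot_Y: "foot B (Y m) = X m"
    and gap_Y: "gap B (Y m) = X (Suc m)"
    and gap_X_Suc: "gap B (X (Suc m)) = Y m"
    and side_X: "side B (X m) = (if \<tau> m then X (m + n) else Y (m + n))"
    and side_Y: "side B (Y m) = (if \<tau> m then Y (m + n) else X (m + n))"
    and twist_add: "\<tau> (m + n) = \<tau> m"
begin

lemma X_in [simp]: "X m \<in> flags B" and Y_in [simp]: "Y m \<in> flags B"
  by (simp_all add: flags_eq)

lemma Y_ne_X: "Y a \<noteq> X b"
  using X_ne_Y by metis

text \<open>\<open>gap_X_Suc\<close> speaks only of successor indices. Adding a full turn gives even
  end 0 a predecessor.\<close>

lemma X_eq_SucD: "\<exists>j. X m = X (Suc j) \<and> (m mod (2 * n) = Suc j mod (2 * n))"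
proof -
  have "Suc (m + 2 * n - 1) = m + 2 * n"
    using n_pos by simp
  then have "X m = X (Suc (m + 2 * n - 1))"
    unfolding X_eq_iff by simp
  then show ?thesis
    using X_eq_iff by blast
qed

lemma flag_cases [consumes 1, case_names X Y]:
  assumes "z \<in> flags B"
  obtains m where "z = X m" | m where "z = Y m"
  using assms by (auto simp: flags_eq)

lemma flag_cases_Suc [consumes 1, case_names X Y]:
  assumes "z \<in> flags B"
  obtains j where "z = X (Suc j)" | m where "z = Y m"
  using assms X_eq_SucD by (auto simp: flags_eq)

lemma add_n_mod_ne: "(m + n) mod (2 * n) \<noteq> m mod (2 * n)"
proof
  assume "(m + n) mod (2 * n) = m mod (2 * n)"
  then have "2 * n dvd n"
    by (metis add_diff_cancel_left' le_add1 mod_eq_dvd_iff_nat)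
  then show False
    using n_pos by (auto dest: dvd_imp_le)
qed

lemma X_add: "X (m + n + n) = X m" and Y_add: "Y (m + n + n) = Y m"
proof -
  have "(m + n + n) mod (2 * n) = m mod (2 * n)"
    using mod_add_self2[of m "2 * n"] by (simp add: mult_2 add.assoc)
  then show "X (m + n + n) = X m" "Y (m + n + n) = Y m"
    by (simp_all add: X_eq_iff Y_eq_iff)
qed

lemma is_ribbon_graph: "is_ribbon_graph B"
proof -
  have "range X = X ` {..<2 * n}" "range Y = Y ` {..<2 * n}"
  proof safe
    fix m
    have "X m = X (m mod (2 * n))" "Y m = Y (m mod (2 * n))" "m mod (2 * n) < 2 * n"
      using n_pos by (simp_all add: X_eq_iff Y_eq_iff)
    then show "X m \<in> X ` {..<2 * n}" "Y m \<in> Y ` {..<2 * n}"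
      by blast+
  qed auto
  then have "finite (flags B)"
    by (simp add: flags_eq)
  moreover have "fixfree_involution_on (flags B) (foot B)"
    unfolding fixfree_involution_on_def
    by (auto elim!: flag_cases simp: foot_X foot_Y X_ne_Y Y_ne_X)
  moreover have "fixfree_involution_on (flags B) (side B)"
  proof -
    have "X (m + n) \<noteq> X m" "Y (m + n) \<noteq> Y m" for m
      by (simp_all add: X_eq_iff Y_eq_iff add_n_mod_ne)
    then show ?thesis
      unfolding fixfree_involution_on_def
      by (auto elim!: flag_cases simp: side_X side_Y X_ne_Y Y_ne_X twist_add X_add Y_add
          split: if_splits)
  qed
  moreover have "fixfree_involution_on (flags B) (gap B)"
    unfolding fixfree_involution_on_def
    by (auto elim!: flag_cases_Suc simp: gap_Y gap_X_Suc X_ne_Y Y_ne_X)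
  moreover have "foot B (side B x) = side B (foot B x) \<and> foot B x \<noteq> side B x"
    if "x \<in> flags B" for x
    using that
    by (cases rule: flag_cases)
      (auto simp: foot_X foot_Y side_X side_Y X_ne_Y Y_ne_X X_eq_iff Y_eq_iff add_n_mod_ne
        add_n_mod_ne[symmetric])
  ultimately show ?thesis
    by (simp add: is_ribbon_graph_def)
qed

sublocale ribbon B
  by unfold_locales (rule is_ribbon_graph)

lemma reach_foot_gap:
  assumes "x \<in> flags B" "y \<in> flags B"
  shows "reach (flags B) {foot B, gap B} x y"
proof -
  have foot_step: "reach (flags B) {foot B, gap B} (X m) (Y m)" for m
    using reach_step[of "X m" "flags B" "foot B"] by (simp add: foot_X)
  have gap_step: "reach (flags B) {foot B, gap B} (Y m) (X (Suc m))" for m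
    using reach_step[of "Y m" "flags B" "gap B"] by (simp add: gap_Y)
  have X: "reach (flags B) {foot B, gap B} (X 0) (X m)" for m
    by (induction m) (use foot_step gap_step reach_trans in \<open>metis reach_refl\<close>)+
  have base: "reach (flags B) {foot B, gap B} (X 0) z" if "z \<in> flags B" for z
    using that by (cases rule: flag_cases) (use X foot_step reach_trans in metis)+
  have "reach (flags B) {foot B, gap B} x (X 0)"
    using base[OF assms(1)] by (rule reach_sym) (use involutions in auto)
  then show ?thesis
    using base[OF assms(2)] by (rule reach_trans)
qed

lemma flags_nonempty: "flags B \<noteq> {}"
  by (auto simp: flags_eq)

lemma num_vertices: "num_vertices B = 1"
proof -
  have "card (orbits (flags B) {foot B, gap B}) = 1"
    by (intro card_orbits_transitive flags_nonempty reach_foot_gap) auto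
  then show ?thesis
    by (simp add: num_vertices_def isolated_eq)
qed

lemma num_components: "num_components B = 1"
proof -
  have "card (orbits (flags B) {foot B, side B, gap B}) = 1"
    by (intro card_orbits_transitive flags_nonempty reach_mono[OF reach_foot_gap]) auto
  then show ?thesis
    by (simp add: num_components_def isolated_eq)
qed

lemma bouquet: "bouquet B"
  using is_ribbon_graph num_vertices by (simp add: bouquet_def)

section \<open>Ribbons of an antipodal bouquet and their interlacement\<close>

definition E :: "nat \<Rightarrow> 'f set" where
  "E m = {X m, Y m, X (m + n), Y (m + n)}"

lemma edge_of_X: "edge_of B (X m) = E m" and edge_of_Y: "edge_of B (Y m) = E m"
  by (auto simp: edge_of_def E_def foot_X foot_Y side_X side_Y)

text \<open>A residue modulo \<open>n\<close> lifts to exactly two residues modulo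
  \<open>2 * n\<close>, which differ by \<open>n\<close>; these are the two ends of one
  ribbon.\<close>

lemma mod_eq_cases:
  "a mod n = b mod n \<longleftrightarrow> a mod (2 * n) = b mod (2 * n) \<or> a mod (2 * n) = (b + n) mod (2 * n)"
proof
  assume *: "a mod n = b mod n"
  have split: "c mod (2 * n) = c mod n \<or> c mod (2 * n) = c mod n + n" for c
  proof -
    have "c mod (2 * n) = n * (c div n mod 2) + c mod n"
      by (simp add: mod_mult2_eq mult.commute[of 2])
    then show ?thesis
      by (cases "c div n mod 2 = 0") (auto simp: not_mod_2_eq_0_eq_1)
  qed
  show "a mod (2 * n) = b mod (2 * n) \<or> a mod (2 * n) = (b + n) mod (2 * n)"
    using split[of a] split[of b] split[of "b + n"] * add_n_mod_ne[of b] by auto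
next
  have "c mod (2 * n) mod n = c mod n" for c
    by (simp add: mod_mod_cancel)
  moreover assume "a mod (2 * n) = b mod (2 * n) \<or> a mod (2 * n) = (b + n) mod (2 * n)"
  ultimately show "a mod n = b mod n"
    by (metis mod_add_self2)
qed

lemma X_mem_E: "X a \<in> E b \<longleftrightarrow> a mod n = b mod n"
  by (auto simp: E_def X_ne_Y Y_ne_X X_eq_iff Y_eq_iff mod_eq_cases)

lemma E_eq_iff: "E a = E b \<longleftrightarrow> a mod n = b mod n"
proof
  assume "E a = E b"
  moreover have "X a \<in> E a" by (simp add: X_mem_E)
  ultimately show "a mod n = b mod n" by (simp add: X_mem_E)
next
  assume "a mod n = b mod n"
  then have "X a \<in> edge_of B (X b)" by (simp add: edge_of_X X_mem_E)
  then show "E a = E b" by (simp add: mem_edge_of_iff flip: edge_of_X)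
qed

lemma edges_eq_range: "edges B = range E"
  by (auto simp: edges_eq flags_eq edge_of_X edge_of_Y image_Un image_image)

lemma edges_eq_image: "edges B = E ` {..<n}"
proof -
  have "E m = E (m mod n)" "m mod n < n" for m
    using n_pos by (simp_all add: E_eq_iff)
  then show ?thesis
    unfolding edges_eq_range by blast
qed

lemma inj_on_E: "inj_on E {..<n}"
  by (rule inj_onI) (simp add: E_eq_iff)

lemma card_edges: "card (edges B) = n"
  by (simp add: edges_eq_image card_image inj_on_E)

lemma next_end_pow_X: "(next_end B ^^ m) (X a) = X (a + m)"
  by (induction m) (simp_all add: next_end_def foot_X gap_Y)

text \<open>The walk from \<open>X a\<close> meets the ends \<open>b\<close>, \<open>a + n\<close>
  and \<open>b + n\<close> in this order. The last is reached after \<open>b - a + n < 2 * n\<close>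
  steps, within a single turn.\<close>

lemma interlaced_E:
  assumes "a < b" "b < a + n"
  shows "interlaced B (E a) (E b)"
proof -
  have "b mod n \<noteq> a mod n"
  proof
    assume "b mod n = a mod n"
    then have "n dvd b - a"
      using assms mod_eq_dvd_iff_nat[of a b n] by auto
    then show False
      using assms by (auto dest: dvd_imp_le)
  qed
  then have "E a \<noteq> E b"
    by (simp add: E_eq_iff)
  moreover have "inj_on (\<lambda>m. (next_end B ^^ m) (X a)) {..b - a + n}"
  proof (rule linorder_inj_onI')
    fix i j assume "i \<in> {..b - a + n}" "j \<in> {..b - a + n}" "i < j"
    then have "j - i < 2 * n" "0 < j - i"
      using assms by auto
    then have "\<not> 2 * n dvd (a + j) - (a + i)"
      using nat_dvd_not_less[of "j - i" "2 * n"] by simp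
    then show "(next_end B ^^ i) (X a) \<noteq> (next_end B ^^ j) (X a)"
      unfolding next_end_pow_X X_eq_iff
      using mod_eq_dvd_iff_nat[of "a + i" "a + j" "2 * n"] \<open>i < j\<close> by auto
  qed
  moreover have "(next_end B ^^ (b - a)) (X a) \<in> E b" "(next_end B ^^ n) (X a) \<in> E a"
    "(next_end B ^^ (b - a + n)) (X a) \<in> E b" "X a \<in> E a"
    using assms by (simp_all add: next_end_pow_X X_mem_E)
  moreover have "0 < b - a" "b - a < n" "n < b - a + n"
    using assms by auto
  ultimately show ?thesis
    unfolding interlaced_def by blast
qed

lemma interlaced_edges:
  assumes "e \<in> edges B" "f \<in> edges B" "e \<noteq> f"
  shows "interlaced B e f"
proof -
  obtain a b where ab: "a < n" "b < n" "e = E a" "f = E b"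
    using assms by (auto simp: edges_eq_image)
  then have "a \<noteq> b" using assms by auto
  show ?thesis
  proof (cases "a < b")
    case True
    then show ?thesis using interlaced_E[of a b] ab by simp
  next
    case False
    \<comment> \<open>The ribbon of \<open>b\<close> also has the end \<open>b + n\<close>, which
      lies strictly between \<open>a\<close> and \<open>a + n\<close> when
      \<open>b < a < n\<close>.\<close>
    have "E (b + n) = E b" by (simp add: E_eq_iff)
    then show ?thesis
      using interlaced_E[of a "b + n"] ab False \<open>a \<noteq> b\<close> by simp
  qed
qed

end

section \<open>Boundary components\<close>

context antipodal
begin

definition index :: "'f \<Rightarrow> nat" where
  "index z = (THE m. m < 2 * n \<and> (z = X m \<or> z = Y m))"

lemma index_X [simp]: "index (X m) = m mod (2 * n)"
  unfolding index_def
  by (rule the_equality) (use n_pos in \<open>auto simp: X_ne_Y X_eq_iff\<close>)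

lemma index_Y [simp]: "index (Y m) = m mod (2 * n)"
  unfolding index_def
  by (rule the_equality) (use n_pos in \<open>auto simp: Y_ne_X Y_eq_iff\<close>)

lemma twist_cong:
  assumes "a mod (2 * n) = b mod (2 * n)"
  shows "\<tau> a = \<tau> b"
proof -
  have "\<tau> (c + n * q) = \<tau> c" for c q
  proof (induction q)
    case (Suc q)
    have "c + n * Suc q = c + n * q + n" by simp
    then show ?case using Suc twist_add by metis
  qed simp
  moreover have "c mod (2 * n) + n * (2 * (c div (2 * n))) = c" for c
    by (metis mod_mult_div_eq mult.assoc mult.commute)
  ultimately have "\<tau> c = \<tau> (c mod (2 * n))" for c
    by metis
  then show ?thesis
    using assms by metis
qed

section \<open>Boundary walks as moves between gaps\<close>

abbreviation conn :: "'f \<Rightarrow> 'f \<Rightarrow> bool" where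
  "conn \<equiv> reach (flags B) {side B, gap B}"

lemma conn_sym: "conn x y \<Longrightarrow> conn y x"
  by (erule reach_sym) (use involutions in auto)

lemma conn_gap: "conn (Y j) (X (Suc j))"
  using reach_step[of "Y j" "flags B" "gap B"] by (simp add: gap_Y)

lemma conn_side: "z \<in> flags B \<Longrightarrow> conn z (side B z)"
  by (rule reach_step) auto

lemma conn_twisted:
  assumes "\<tau> j"
  shows "conn (Y j) (Y (j + n))"
  using conn_side[of "Y j"] assms by (simp add: side_Y)

text \<open>An untwisted ribbon leads from one side of an end to the other side of the opposite end,
  so that the gap number shifts by one besides \<open>n\<close>. A twisted ribbon keeps the
  side.\<close>

lemma conn_untwisted:
  assumes "\<not> \<tau> (Suc j)"
  shows "conn (Y (Suc j)) (Y (j + n))" "conn (Y j) (Y (Suc j + n))"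
proof -
  have "conn (Y (Suc j)) (X (Suc (j + n)))" "conn (X (Suc j)) (Y (Suc j + n))"
    using conn_side[of "Y (Suc j)"] conn_side[of "X (Suc j)"] assms by (simp_all add: side_Y side_X)
  then show "conn (Y (Suc j)) (Y (j + n))" "conn (Y j) (Y (Suc j + n))"
    using reach_trans[OF _ conn_sym[OF conn_gap]] reach_trans[OF conn_gap] by blast+
qed

text \<open>The gap between the ends \<open>g\<close> and \<open>g + 1\<close> has the corners \<open>Y g\<close> and \<open>X (g + 1)\<close>. Here \<open>c g\<close> is a
  representative of the boundary component through that gap.\<close>

lemma card_boundary:
  fixes c :: "nat \<Rightarrow> nat"
  assumes period: "\<And>g. c (g mod (2 * n)) = c g"
    and conn_c: "\<And>g. conn (Y g) (Y (c g))"
    and twisted: "\<And>j. \<tau> j \<Longrightarrow> c (j + n) = c j"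
    and twisted_Suc: "\<And>j. \<tau> (Suc j) \<Longrightarrow> c (j + n) = c j"
    and untwisted: "\<And>j. \<not> \<tau> (Suc j) \<Longrightarrow> c (j + n) = c (Suc j)"
    and untwisted_Suc: "\<And>j. \<not> \<tau> (Suc j) \<Longrightarrow> c (Suc (j + n)) = c j"
  shows "card (orbits (flags B) {side B, gap B}) = card (range c)"
proof -
  \<comment> \<open>The corner \<open>X g\<close> lies on gap \<open>g - 1\<close>. Adding
    \<open>2 * n\<close> before subtracting 1 avoids truncation at index 0.\<close>
  define h where "h z = (if z \<in> range X then c (index z + 2 * n - 1) else c (index z))" for z
  have c_cong: "c a = c b" if "a mod (2 * n) = b mod (2 * n)" for a b
    using period that by metis
  have h_Y: "h (Y m) = c m" for m
    using Y_ne_X by (auto simp: h_def period)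
  have h_X: "h (X (Suc m)) = c m" for m
  proof -
    have "(Suc m mod (2 * n) + 2 * n - 1) = Suc m mod (2 * n) + (2 * n - 1)"
      using n_pos by simp
    then have "(Suc m mod (2 * n) + 2 * n - 1) mod (2 * n) = (Suc m + (2 * n - 1)) mod (2 * n)"
      by (simp add: mod_add_left_eq)
    also have "Suc m + (2 * n - 1) = m + 2 * n"
      using n_pos by simp
    finally show ?thesis
      by (auto simp: h_def intro!: c_cong)
  qed
  have h_side: "h (side B z) = h z" if "z \<in> flags B" for z
    using that
  proof (cases rule: flag_cases_Suc)
    case (X j)
    then show ?thesis
      using h_X[of "j + n"] h_Y twisted_Suc[of j] untwisted_Suc[of j] by (simp add: side_X h_X)
  next
    case (Y m)
    obtain j where j: "m mod (2 * n) = Suc j mod (2 * n)"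
      using X_eq_SucD by blast
    then have "Y m = Y (Suc j)" "\<tau> m = \<tau> (Suc j)"
      by (simp add: Y_eq_iff, rule twist_cong)
    then show ?thesis
      using Y h_X[of "j + n"] h_Y twisted[of "Suc j"] untwisted[of j] h_Y[of "Suc (j + n)"]
      by (simp add: side_Y h_Y)
  qed
  have h_gap: "h (gap B z) = h z" if "z \<in> flags B" for z
    using that by (cases rule: flag_cases_Suc) (simp_all add: gap_Y gap_X_Suc h_X h_Y)
  have conn_h: "conn z (Y (h z))" if "z \<in> flags B" for z
    using that
  proof (cases rule: flag_cases_Suc)
    case (X j)
    then show ?thesis
      using reach_trans[OF conn_sym[OF conn_gap] conn_c] by (simp add: h_X)
  next
    case (Y m)
    then show ?thesis using h_Y conn_c by simp
  qed
  have "card (orbits (flags B) {side B, gap B}) = card (h ` flags B)"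
  proof (rule card_orbits)
    show "conn x y" if "x \<in> flags B" "y \<in> flags B" "h x = h y" for x y
      using conn_h[OF that(1)] conn_sym[OF conn_h[OF that(2)]] unfolding that(3)
      by (rule reach_trans)
  qed (use h_side h_gap in auto)
  moreover have "h ` flags B = range c"
  proof safe
    fix z assume "z \<in> flags B"
    then show "h z \<in> range c"
      by (cases rule: flag_cases_Suc) (auto simp: h_X h_Y)
  next
    fix g
    show "c g \<in> h ` flags B"
      using h_Y[of g] by (metis Y_in image_eqI)
  qed
  ultimately show ?thesis by simp
qed

text \<open>Names the block of gap \<open>g\<close> by the twisted end that opens it. The default 0
  is such an end only if end 0 is twisted, as the next lemma assumes.\<close>

primrec last_twisted :: "nat \<Rightarrow> nat" where
  "last_twisted 0 = 0"
| "last_twisted (Suc g) = (if \<tau> (Suc g) then Suc g else last_twisted g)"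

text \<open>With end 0 twisted, no block wraps around from \<open>n - 1\<close> to 0, so the blocks
  modulo \<open>n\<close> can be named by \<open>last_twisted\<close>. Every name is a twisted end
  below \<open>n\<close>, and every such end names its own block.\<close>

lemma card_boundary_if_twist_0:
  assumes "\<tau> 0"
  shows "card (orbits (flags B) {side B, gap B}) = card {i. i < n \<and> \<tau> i}"
proof -
  define c where "c g = last_twisted (g mod n)" for g
  have lt: "\<tau> (last_twisted g) \<and> last_twisted g \<le> g" for g
    by (induction g) (auto simp: assms)
  have lt_id: "last_twisted g = g" if "\<tau> g" for g
    using that by (cases g) auto
  have twist_n: "\<tau> (m mod n) = \<tau> m" for m
  proof -
    have "m mod n mod n = m mod n" by simp
    then show ?thesis
      unfolding mod_eq_cases using twist_cong[of "m mod n"] twist_add by metis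
  qed
  \<comment> \<open>The two claims need a joint induction: an untwisted ribbon leads from gap
    \<open>g + 1\<close> to gap \<open>g + n\<close>, and the first claim leads back from there to
    \<open>g\<close>.\<close>
  have block: "conn (Y g) (Y (g + n)) \<and> conn (Y g) (Y (last_twisted g))" for g
  proof (induction g)
    case 0
    then show ?case using conn_twisted[OF assms] by simp
  next
    case (Suc g)
    show ?case
    proof (cases "\<tau> (Suc g)")
      case True
      then show ?thesis using conn_twisted[OF True] by simp
    next
      case False
      have "conn (Y (Suc g)) (Y g)"
        using conn_untwisted(1)[OF False] conn_sym[OF conjunct1[OF Suc]] by (rule reach_trans)
      then show ?thesis
        using reach_trans[OF _ conn_untwisted(2)[OF False]] reach_trans[OF _ conjunct2[OF Suc]] False
        by simp
    qed
  qed
  \<comment> \<open>Since end 0 is twisted, an untwisted end is no multiple of \<open>n\<close>, and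
    the residue modulo \<open>n\<close> grows by one without wrapping.\<close>
  have c_Suc: "c (Suc j) = c j" if "\<not> \<tau> (Suc j)" for j
  proof -
    have "Suc j mod n \<noteq> 0"
      using that assms twist_n[of "Suc j"] by metis
    then have "Suc j mod n = Suc (j mod n)"
      by (auto simp: mod_Suc)
    then show ?thesis
      using that twist_n[of "Suc j"] by (simp add: c_def)
  qed
  have "card (orbits (flags B) {side B, gap B}) = card (range c)"
  proof (rule card_boundary)
    show "c (g mod (2 * n)) = c g" for g
      by (simp add: c_def mod_mod_cancel)
    show "conn (Y g) (Y (c g))" for g
    proof -
      have "g mod n mod n = g mod n" by simp
      then have "Y (g mod n) = Y g \<or> Y (g mod n) = Y (g + n)"
        unfolding mod_eq_cases by (simp add: Y_eq_iff)
      then have "conn (Y g) (Y (g mod n))"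
        using block[of g] by auto
      then show ?thesis
        unfolding c_def using conjunct2[OF block[of "g mod n"]] by (rule reach_trans)
    qed
    show "c (Suc (j + n)) = c j" if "\<not> \<tau> (Suc j)" for j
      using c_Suc[OF that] by (simp add: c_def mod_add_self2[of "Suc j" n, simplified])
  qed (simp_all add: c_def c_Suc[unfolded c_def])
  also have "range c = {i. i < n \<and> \<tau> i}"
  proof safe
    fix g
    have "g mod n < n" using n_pos by simp
    then show "c g < n" "\<tau> (c g)"
      using lt[of "g mod n"] by (auto simp: c_def)
  next
    fix i assume "i < n" "\<tau> i"
    then show "i \<in> range c"
      using lt_id by (auto simp: c_def intro!: image_eqI[of _ _ i])
  qed
  finally show ?thesis .
qed

text \<open>Each step advances by \<open>n + 1\<close> gaps, so two steps advance by 2 modulo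
  \<open>2 * n\<close> and join all gaps of equal parity. A single step changes the parity exactly
  when \<open>n\<close> is even.\<close>

lemma card_boundary_untwisted:
  assumes "\<And>m. \<not> \<tau> m"
  shows "card (orbits (flags B) {side B, gap B}) = (if even n then 1 else 2)"
proof -
  have step: "conn (Y g) (Y (Suc g + n))" for g
    using conn_untwisted assms by blast
  have two: "conn (Y g) (Y (g + 2))" for g
  proof -
    have "conn (Y g) (Y (Suc (Suc g + n) + n))"
      using step step by (rule reach_trans)
    then show ?thesis
      using Y_add[of "g + 2"] by simp
  qed
  have parity: "conn (Y g) (Y (g mod 2))" for g
  proof (induction g rule: less_induct)
    case (less g)
    show ?case
    proof (cases "g < 2")
      case False
      then have "conn (Y (g - 2)) (Y (g mod 2))"
        using less[of "g - 2"] by (simp add: le_mod_geq)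
      moreover have "conn (Y (g - 2)) (Y g)"
        using two[of "g - 2"] le_add_diff_inverse2[of 2 g] False by (metis not_less)
      ultimately show ?thesis
        using reach_trans[OF conn_sym] by blast
    qed simp
  qed
  define c where "c g = (if even n then 0 else g mod 2)" for g :: nat
  have "card (orbits (flags B) {side B, gap B}) = card (range c)"
  proof (rule card_boundary)
    show "c (g mod (2 * n)) = c g" for g
      by (simp add: c_def mod_mod_cancel)
    show "conn (Y g) (Y (c g))" for g
    proof (cases "even n")
      case True
      \<comment> \<open>One step from gap 1 leads to gap \<open>2 + n\<close>, which is even here;
        this joins the two parity classes.\<close>
      have "conn (Y 1) (Y ((2 + n) mod 2))"
        using reach_trans[OF step[of 1] parity] by simp
      then have "conn (Y (g mod 2)) (Y 0)"
        using True by (cases "g mod 2 = 0") (simp_all add: not_mod_2_eq_0_eq_1)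
      then show ?thesis
        using reach_trans[OF parity[of g]] True by (simp add: c_def)
    next
      case False
      then show ?thesis using parity by (simp add: c_def)
    qed
    show "c (j + n) = c (Suc j)" for j
      by (simp add: c_def mod2_eq_if)
    show "c (Suc (j + n)) = c j" for j
      by (simp add: c_def mod2_eq_if)
  qed (use assms in auto)
  also have "range c = (if even n then {0} else {0, 1})"
  proof -
    have "range (\<lambda>g::nat. g mod 2) \<subseteq> {0, 1}"
      by auto
    moreover have "{0, 1} \<subseteq> range (\<lambda>g::nat. g mod 2)"
      using image_mono[OF subset_UNIV, of "\<lambda>g::nat. g mod 2" "{0, 1}"] by simp
    ultimately have "range (\<lambda>g::nat. g mod 2) = {0, 1}"
      by (rule equalityI)
    then show ?thesis
      unfolding c_def by auto
  qed
  finally show ?thesis by simp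
qed

section \<open>Moving the starting end of the numbering\<close>

lemma antipodal_Suc: "antipodal B n (\<lambda>m. X (Suc m)) (\<lambda>m. Y (Suc m)) (\<lambda>m. \<tau> (Suc m))"
proof -
  have Suc_iff: "Suc a mod (2 * n) = Suc b mod (2 * n) \<longleftrightarrow> a mod (2 * n) = b mod (2 * n)" for a b
    by (auto simp: mod_Suc)
  have range: "range Z = range (\<lambda>m. Z (Suc m))"
    if "\<And>a b. Z a = Z b \<longleftrightarrow> a mod (2 * n) = b mod (2 * n)" for Z :: "nat \<Rightarrow> 'f"
  proof (intro equalityI subsetI)
    fix z assume "z \<in> range Z"
    then obtain m where "z = Z m"
      by blast
    moreover obtain j where "m mod (2 * n) = Suc j mod (2 * n)"
      using X_eq_SucD by blast
    ultimately have "z = Z (Suc j)"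
      by (simp add: that)
    then show "z \<in> range (\<lambda>m. Z (Suc m))"
      by blast
  qed blast
  show ?thesis
  proof
    show "flags B = range (\<lambda>m. X (Suc m)) \<union> range (\<lambda>m. Y (Suc m))"
      using range[of X, OF X_eq_iff] range[of Y, OF Y_eq_iff] flags_eq by simp
  qed (use twist_add[of "Suc _"] in \<open>simp_all add: n_pos isolated_eq X_eq_iff Y_eq_iff X_ne_Y foot_X
      foot_Y gap_Y gap_X_Suc side_X side_Y Suc_iff\<close>)
qed

text \<open>The shift loses the summand at 0 and gains the one at \<open>n\<close>, and these agree
  because \<open>\<tau>\<close> has period \<open>n\<close>.\<close>

lemma card_twisted_Suc: "card {i. i < n \<and> \<tau> (Suc i)} = card {i. i < n \<and> \<tau> i}"
proof -
  have sum: "card {i. i < n \<and> P i} = (\<Sum>i<n. of_bool (P i))" for P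
    by (simp add: of_bool_def flip: sum.inter_filter)
  have "(\<Sum>i<Suc n. of_bool (\<tau> i) :: nat) = of_bool (\<tau> 0) + (\<Sum>i<n. of_bool (\<tau> (Suc i)))"
    by (rule sum.lessThan_Suc_shift)
  then show ?thesis
    using twist_add[of 0] by (simp add: sum)
qed

end

text \<open>\<open>antipodal_axioms\<close> enters the induction as a premise so that the numbering
  may vary. Each step renumbers by one end until the twisted end has number 0.\<close>

lemma (in antipodal) card_boundary_if_twist:
  assumes "\<tau> s"
  shows "card (orbits (flags B) {side B, gap B}) = card {i. i < n \<and> \<tau> i}"
  using antipodal_axioms assms
proof (induction s arbitrary: X Y \<tau>)
  case 0
  then show ?case by (rule antipodal.card_boundary_if_twist_0)
next
  case (Suc s)
  have "antipodal B n (\<lambda>m. X (Suc m)) (\<lambda>m. Y (Suc m)) (\<lambda>m. \<tau> (Suc m))"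
    using Suc.prems(1) by (rule antipodal.antipodal_Suc)
  then show ?case
    using Suc.IH[of _ _ "\<lambda>m. \<tau> (Suc m)"] Suc.prems antipodal.card_twisted_Suc by simp
qed

context antipodal
begin

lemma card_boundary_eq:
  "card (orbits (flags B) {side B, gap B}) =
    (if {i. i < n \<and> \<tau> i} = {} then if even n then 1 else 2 else card {i. i < n \<and> \<tau> i})"
proof (cases "\<exists>s. \<tau> s")
  case True
  then have "card (orbits (flags B) {side B, gap B}) = card {i. i < n \<and> \<tau> i}"
    using card_boundary_if_twist by blast
  \<comment> \<open>The twisted \<open>s\<close> need not be below \<open>n\<close>. That some
    twisted end is below \<open>n\<close> follows from the boundary being nonempty.\<close>
  moreover have "card (orbits (flags B) {side B, gap B}) \<noteq> 0"
  proof -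
    have "finite (orbits (flags B) {side B, gap B})"
      unfolding orbits_def quotient_def using finite_flags by simp
    moreover have "orbits (flags B) {side B, gap B} \<noteq> {}"
      using flags_nonempty by (auto simp: orbits_def quotient_def)
    ultimately show ?thesis by simp
  qed
  ultimately show ?thesis by (auto simp: card_gt_0_iff)
next
  case False
  then show ?thesis
    using card_boundary_untwisted by auto
qed

end

section \<open>Partial Petrials\<close>

text \<open>This is \<open>2 - 1 + n - f\<close> for \<open>f\<close> boundary components:
  \<open>f = k\<close> if \<open>k > 0\<close>, while for \<open>k = 0\<close> it is 1 or 2
  according to the parity of \<open>n\<close>.\<close>

definition twist_genus :: "nat \<Rightarrow> nat \<Rightarrow> nat" where
  "twist_genus n k = (if k = 0 then if even n then n else n - 1 else n + 1 - k)"

context antipodal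
begin

text \<open>Composing \<open>side\<close> with \<open>foot\<close> exchanges the \<open>X\<close>
  and \<open>Y\<close> corners reached at the opposite end. So the half-twists toggle
  \<open>\<tau>\<close> exactly on the ribbons in \<open>A\<close> and leave the numbering
  intact.\<close>

lemma antipodal_partial_petrial:
  assumes "A \<subseteq> edges B"
  shows "antipodal (partial_petrial B A) n X Y (\<lambda>m. \<tau> m \<noteq> (E m \<in> A))"
proof -
  have X_mem: "X m \<in> \<Union>A \<longleftrightarrow> E m \<in> A" for m
  proof
    assume "X m \<in> \<Union>A"
    then obtain b where "E b \<in> A" "X m \<in> E b"
      using assms by (auto simp: edges_eq_range)
    then show "E m \<in> A"
      using E_eq_iff[of m b] by (simp add: X_mem_E)
  next
    assume "E m \<in> A"
    then show "X m \<in> \<Union>A"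
      by (auto simp: E_def)
  qed
  have Y_mem: "Y m \<in> \<Union>A \<longleftrightarrow> E m \<in> A" for m
  proof -
    have "Y m \<in> f \<longleftrightarrow> X m \<in> f" if "f \<in> A" for f
      using foot_mem_edge[of "X m" f] that assms by (auto simp: foot_X)
    then show ?thesis
      using X_mem[of m] by blast
  qed
  have E_add: "E (m + n) = E m" for m
    by (simp add: E_eq_iff)
  show ?thesis
    by unfold_locales
      (auto simp: partial_petrial_def n_pos flags_eq isolated_eq X_eq_iff Y_eq_iff X_ne_Y foot_X
        foot_Y gap_Y gap_X_Suc side_X side_Y twist_add E_add X_mem Y_mem simp del: Union_iff)
qed

lemma euler_genus: "nat (euler_genus B) = twist_genus n (card {i. i < n \<and> \<tau> i})"
proof -
  have "card {i. i < n \<and> \<tau> i} \<le> card {..<n}"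
    by (rule card_mono) auto
  then show ?thesis
    using n_pos
    by (simp add: euler_genus_def num_components num_vertices num_edges_def card_edges
        num_boundary_components_def isolated_eq card_boundary_eq twist_genus_def)
      (auto simp: nat_diff_distrib elim!: oddE)
qed

text \<open>The ribbons twisted after toggling by \<open>A\<close> form the symmetric difference of
  \<open>A\<close> with those twisted in \<open>B\<close>. This is a bijection on subsets, so the
  sum does not depend on \<open>\<tau>\<close>.\<close>

lemma petrial_poly_eq:
  "petrial_poly B = (\<Sum>S\<in>Pow {..<n}. monom 1 (twist_genus n (card S)))"
proof -
  let ?tw = "\<lambda>A. {i. i < n \<and> (\<tau> i \<noteq> (E i \<in> A))}"
  let ?inv = "\<lambda>S. E ` {i. i < n \<and> (\<tau> i \<noteq> (i \<in> S))}"
  have "petrial_poly B = (\<Sum>A\<in>Pow (edges B). monom 1 (twist_genus n (card (?tw A))))"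
    unfolding petrial_poly_def
    by (rule sum.cong) (simp_all add: antipodal.euler_genus[OF antipodal_partial_petrial])
  also have "\<dots> = (\<Sum>S\<in>Pow {..<n}. monom 1 (twist_genus n (card S)))"
  proof (rule sum.reindex_bij_witness[of _ ?inv ?tw])
    fix A assume "A \<in> Pow (edges B)"
    then show "?inv (?tw A) = A"
      by (auto simp: edges_eq_image)
  next
    fix S assume "S \<in> Pow {..<n}"
    moreover have "E i \<in> ?inv S \<longleftrightarrow> \<tau> i \<noteq> (i \<in> S)" if "i < n" for i
      using that inj_onD[OF inj_on_E, of i] by auto
    ultimately show "?tw (?inv S) = S"
      by blast
  qed (auto simp: edges_eq_image)
  finally show ?thesis .
qed

end

section \<open>Summation over sets of twisted ribbons by size\<close>

lemma sum_Pow_card: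
  fixes g :: "nat \<Rightarrow> nat"
  shows "(\<Sum>S\<in>Pow {..<n}. monom (1::int) (g (card S))) = (\<Sum>k\<le>n. monom (of_nat (n choose k)) (g k))"
proof -
  have "card S \<le> n" if "S \<subseteq> {..<n}" for S
    using card_mono[OF _ that] by simp
  then have "(\<Sum>S\<in>Pow {..<n}. monom (1::int) (g (card S))) =
      (\<Sum>k\<le>n. \<Sum>S | S \<in> Pow {..<n} \<and> card S = k. monom 1 (g (card S)))"
    by (intro sum.group[symmetric]) auto
  also have "\<dots> = (\<Sum>k\<le>n. monom (of_nat (n choose k)) (g k))"
  proof (rule sum.cong[OF refl])
    fix k
    have "of_nat m * monom (1::int) d = monom (of_nat m) d" for m d
      by (simp add: of_nat_poly smult_monom)
    moreover have "card {S. S \<subseteq> {..<n} \<and> card S = k} = n choose k"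
      using n_subsets[of "{..<n}" k] by simp
    moreover have "(\<Sum>S | S \<in> Pow {..<n} \<and> card S = k. monom (1::int) (g (card S))) =
        (\<Sum>S | S \<subseteq> {..<n} \<and> card S = k. monom 1 (g k))"
      by (rule sum.cong) auto
    ultimately show "(\<Sum>S | S \<in> Pow {..<n} \<and> card S = k. monom 1 (g (card S))) =
        monom (int (n choose k)) (g k)"
      by simp
  qed
  finally show ?thesis .
qed

lemma (in antipodal) petrial_poly_formula:
  "petrial_poly B =
    (if even n
     then monom 1 n + (\<Sum>i=1..n. monom (of_nat (n choose (n + 1 - i))) i)
     else monom 1 (n - 1) + (\<Sum>i=1..n. monom (of_nat (n choose (n + 1 - i))) i))"
proof -
  have "petrial_poly B = (\<Sum>k\<le>n. monom (of_nat (n choose k)) (twist_genus n k))"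
    by (simp add: petrial_poly_eq sum_Pow_card)
  \<comment> \<open>The term \<open>k = 0\<close> is split off, since only there the genus differs
    from \<open>n + 1 - k\<close>.\<close>
  also have "\<dots> = monom 1 (twist_genus n 0) +
      (\<Sum>k=1..n. monom (of_nat (n choose k)) (twist_genus n k))"
    by (simp add: atMost_atLeast0 sum.atLeast_Suc_atMost)
  also have "(\<Sum>k=1..n. monom (int (n choose k)) (twist_genus n k)) =
      (\<Sum>i=1..n. monom (of_nat (n choose (n + 1 - i))) i)"
    by (rule sum.reindex_bij_witness[of _ "\<lambda>i. n + 1 - i" "\<lambda>k. n + 1 - k"])
      (auto simp: twist_genus_def)
  finally show ?thesis
    by (simp add: twist_genus_def)
qed

section \<open>Bouquets with complete intersection graph\<close>

text \<open>The root is a parameter because the ends are numbered from it, and one bouquet is later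
  rooted at several flags.\<close>

locale rooted_bouquet =
  fixes B :: "'f ribbon_graph" and x0 :: 'f
  assumes bouquet: "bouquet B" and root: "x0 \<in> flags B"
begin

sublocale ribbon B
  using bouquet by unfold_locales (simp add: bouquet_def)

section \<open>Periodicity of the walk around the vertex\<close>

definition X :: "nat \<Rightarrow> 'f" where
  "X m = (next_end B ^^ m) x0"

definition Y :: "nat \<Rightarrow> 'f" where
  "Y m = foot B (X m)"

lemma X_0: "X 0 = x0"
  by (simp add: X_def)

lemma X_Suc: "X (Suc m) = gap B (Y m)"
  by (simp add: X_def Y_def next_end_def)

lemma X_in [simp]: "X m \<in> flags B"
  by (induction m) (simp_all add: X_0 root X_Suc Y_def)

lemma Y_in [simp]: "Y m \<in> flags B"
  by (simp add: Y_def)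

lemma foot_Y: "foot B (Y m) = X m"
  by (simp add: Y_def)

lemma gap_X_Suc: "gap B (X (Suc m)) = Y m"
  by (simp add: X_Suc)

lemma Y_eq_X_iff: "Y a = Y b \<longleftrightarrow> X a = X b"
  by (metis foot_Y Y_def)

lemma X_Suc_eq_iff: "X (Suc a) = X (Suc b) \<longleftrightarrow> X a = X b"
  by (metis gap_X_Suc X_Suc Y_eq_X_iff)

lemma X_add_cancel: "X (a + m) = X (b + m) \<longleftrightarrow> X a = X b"
  by (induction m) (simp_all add: X_Suc_eq_iff)

definition p :: nat where
  "p = (LEAST p. 0 < p \<and> X p = X 0)"

lemma p_pos: "0 < p" and X_p: "X p = X 0"
proof -
  have "finite (range X)"
    by (rule finite_subset[OF _ finite_flags]) auto
  then have "\<not> inj X"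
    using finite_imageD by auto
  then obtain a b where "X a = X b" "a < b"
    unfolding inj_def by (metis linorder_neqE_nat)
  then have "0 < b - a \<and> X (b - a) = X 0"
    using X_add_cancel[of "b - a" a 0] by simp
  from LeastI[of "\<lambda>p. 0 < p \<and> X p = X 0", OF this] show "0 < p" "X p = X 0"
    by (simp_all add: p_def)
qed

lemma X_add_p: "X (m + p) = X m"
  using X_add_cancel[of p m 0] X_p by (simp add: add.commute)

lemma X_mod: "X (m mod p) = X m"
proof -
  have "X (a + p * q) = X a" for a q
  proof (induction q)
    case (Suc q)
    have "a + p * Suc q = a + p * q + p" by simp
    then show ?case using Suc X_add_p by metis
  qed simp
  then show ?thesis
    by (metis mod_mult_div_eq)
qed

lemma X_eq_iff: "X a = X b \<longleftrightarrow> a mod p = b mod p"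
proof
  have *: False if "c < d" "d < p" "X c = X d" for c d
  proof -
    have "0 < d - c \<and> X (d - c) = X 0"
      using X_add_cancel[of "d - c" c 0] that by simp
    then have "p \<le> d - c"
      unfolding p_def by (rule Least_le)
    then show False
      using that by simp
  qed
  assume "X a = X b"
  then have "X (a mod p) = X (b mod p)"
    by (simp add: X_mod)
  then show "a mod p = b mod p"
    using *[of "a mod p" "b mod p"] *[of "b mod p" "a mod p"] p_pos
    by (metis linorder_neqE_nat mod_less_divisor)
qed (metis X_mod)

text \<open>An identity \<open>Y a = X b\<close> would reflect the walk around the vertex, and shrinking it towards its
  centre would produce a fixed point of \<open>foot\<close> or of \<open>gap\<close>.\<close>

lemma X_ne_Y: "X b \<noteq> Y a"
proof -
  have le: "Y a \<noteq> X (a + d)" for a d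
  proof (induction d arbitrary: a rule: less_induct)
    case (less d)
    consider "d = 0" | "d = 1" | c where "d = Suc (Suc c)"
      by (metis One_nat_def old.nat.exhaust)
    then show ?case
    proof cases
      case 1
      then show ?thesis by (simp add: Y_def)
    next
      case 2
      then show ?thesis using not_sym[OF gap(2)[OF Y_in]] by (simp add: X_Suc)
    next
      case 3
      show ?thesis
      proof
        assume "Y a = X (a + d)"
        then have "X (Suc a) = Y (Suc a + c)"
          using gap_X_Suc[of "a + Suc c"] 3 by (simp add: X_Suc)
        then have "Y (Suc a) = X (Suc a + c)"
          by (metis Y_def foot_Y)
        then show False
          using less[of c "Suc a"] 3 by simp
      qed
    qed
  qed
  \<comment> \<open>\<open>le\<close> covers only indices from \<open>a\<close> upwards; adding a
    multiple of the period brings \<open>b\<close> into that range.\<close>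
  have "a \<le> b + p * a"
    using p_pos by (simp add: trans_le_add2)
  then have "Y a \<noteq> X (b + p * a)"
    using le[of a "b + p * a - a"] by simp
  moreover have "X (b + p * a) = X b"
    by (simp add: X_eq_iff)
  ultimately show ?thesis by simp
qed

text \<open>The root yields at least one orbit, so the only vertex is an orbit and not an isolated
  disc.\<close>

lemma orbit_vertex: "isolated B = 0 \<and> card (orbits (flags B) {foot B, gap B}) = 1"
proof -
  have "finite (orbits (flags B) {foot B, gap B})"
    unfolding orbits_def quotient_def using finite_flags by simp
  moreover have "orbits (flags B) {foot B, gap B} \<noteq> {}"
    using root by (auto simp: orbits_def quotient_def)
  ultimately have "card (orbits (flags B) {foot B, gap B}) > 0"
    by (simp add: card_gt_0_iff)
  then show ?thesis
    using bouquet by (simp add: bouquet_def num_vertices_def)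
qed

lemma flags_eq: "flags B = range X \<union> range Y"
proof (intro equalityI subsetI)
  fix z assume "z \<in> flags B"
  then have "reach (flags B) {foot B, gap B} x0 z"
    using reach_if_one_orbit orbit_vertex root by metis
  then show "z \<in> range X \<union> range Y"
  proof (induction rule: reach_induct)
    case refl
    then show ?case using X_0 by (metis UnI1 rangeI)
  next
    case (step u \<phi>)
    \<comment> \<open>The predecessor of end \<open>m\<close> is written as
      \<open>m + (p - 1)\<close>, which makes \<open>gap_X_Suc\<close> applicable also at 0.\<close>
    have "X m = X (Suc (m + (p - 1)))" for m
      using X_add_p[of m] p_pos by simp
    then have "gap B (X m) = Y (m + (p - 1))" for m
      using gap_X_Suc by metis
    then have "\<phi> (X m) \<in> range X \<union> range Y" "\<phi> (Y m) \<in> range X \<union> range Y" for m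
      using step(3) by (auto simp: foot_Y simp flip: Y_def X_Suc)
    then show ?case using step(4) by auto
  qed
qed auto

section \<open>Interlacement seen from the walk\<close>

lemma next_end_pow_X: "(next_end B ^^ m) (X a) = X (a + m)"
  by (simp add: X_def funpow_add add.commute[of a])

text \<open>From a \<open>Y\<close> corner the walk runs in the opposite direction. The bound
  \<open>m \<le> a\<close> keeps the index from truncating.\<close>

lemma next_end_pow_Y: "m \<le> a \<Longrightarrow> (next_end B ^^ m) (Y a) = Y (a - m)"
proof (induction m)
  case (Suc m)
  then have "a - m = Suc (a - Suc m)" by simp
  then show ?case
    using Suc by (simp add: next_end_def foot_Y gap_X_Suc)
qed simp

lemma next_end_pow_p:
  assumes "x \<in> flags B"
  shows "(next_end B ^^ p) x = x"
proof -
  have "(next_end B ^^ p) (X a) = X a" "(next_end B ^^ p) (Y a) = Y a" for a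
    using next_end_pow_X[of p a] next_end_pow_Y[of p "a + p"] X_add_p[of a]
    by (simp_all add: Y_eq_X_iff Y_def)
  then show ?thesis
    using assms by (auto simp: flags_eq)
qed

lemma Y_mem_edge: "f \<in> edges B \<Longrightarrow> Y m \<in> f \<longleftrightarrow> X m \<in> f"
  using foot_mem_edge[of "X m"] by (simp add: Y_def)

text \<open>Of the four corners of a ribbon only two have the form \<open>X\<close>, by
  \<open>X_ne_Y\<close>; the one other than \<open>X a\<close> is therefore unique.\<close>

lemma edge_at_most_two:
  assumes "f \<in> edges B" "X a \<in> f" "X b \<in> f" "X c \<in> f" "X a \<noteq> X b" "X a \<noteq> X c"
  shows "X b = X c"
proof -
  have f: "f = {X a, Y a, side B (X a), foot B (side B (X a))}"
    using edge_eqI(1)[OF assms(1,2)] by (simp add: edge_of_def Y_def)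
  consider d where "side B (X a) = X d" | d where "side B (X a) = Y d"
    using side(1)[of "X a"] by (auto simp: flags_eq simp del: side)
  then show ?thesis
  proof cases
    case 1
    then have "f = {X a, Y a, X d, Y d}"
      using f by (simp add: Y_def)
    then show ?thesis
      using assms X_ne_Y by auto
  next
    case 2
    then have "f = {X a, Y a, Y d, X d}"
      using f by (simp add: foot_Y)
    then show ?thesis
      using assms X_ne_Y by auto
  qed
qed

text \<open>In \<open>interlaced\<close> the walk may start at any corner of \<open>e\<close>, and
  so run in either direction. All four starts yield an end of \<open>f\<close> in each of the two
  arcs between the ends 0 and \<open>q\<close>.\<close>

lemma crossing:
  assumes q: "0 < q" "q < p" and e: "e = {X 0, Y 0, X q, Y q}" "e \<in> edges B"
    and f: "f \<in> edges B" "interlaced B e f"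
  shows "\<exists>a b. 0 < a \<and> a < q \<and> q < b \<and> b < p \<and> X a \<in> f \<and> X b \<in> f"
proof -
  have e_lt: "m = 0 \<or> m = q" if "X m \<in> e" "m < p" for m
    using that q X_ne_Y by (auto simp: e(1) X_eq_iff)
  have X_diff: "X (m - p) = X m" if "p \<le> m" for m
    using X_add_p[of "m - p"] that by simp
  obtain x i j k where x: "x \<in> e" and ijk: "0 < i" "i < j" "j < k"
    and inj: "inj_on (\<lambda>m. (next_end B ^^ m) x) {..k}"
    and mem: "(next_end B ^^ i) x \<in> f" "(next_end B ^^ j) x \<in> e" "(next_end B ^^ k) x \<in> f"
    using f(2) unfolding interlaced_def by blast
  \<comment> \<open>After \<open>p\<close> steps the walk is back at \<open>x\<close>, which
    injectivity up to \<open>k\<close> forbids.\<close>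
  have "k < p"
  proof (rule ccontr)
    assume "\<not> k < p"
    moreover have "(next_end B ^^ p) x = (next_end B ^^ 0) x"
      using next_end_pow_p edge_eqI(2)[OF e(2) x] by simp
    ultimately have "p = 0"
      using inj_onD[OF inj] by auto
    then show False using p_pos by simp
  qed
  \<comment> \<open>\<open>Y 0\<close> and \<open>Y q\<close> are renumbered one turn later, so that
    walking back fewer than \<open>p\<close> steps never falls below index 0.\<close>
  consider "x = X 0" | "x = X q" | "x = Y p" | "x = Y (q + p)"
    using x e(1) X_p X_add_p by (auto simp: Y_eq_X_iff)
  then show ?thesis
  proof cases
    case 1
    then have "X i \<in> f" "X j \<in> e" "X k \<in> f"
      using mem by (simp_all add: next_end_pow_X)
    moreover from this have "j = q"
      using e_lt[of j] ijk \<open>k < p\<close> by auto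
    ultimately show ?thesis
      using ijk \<open>k < p\<close> by blast
  next
    case 2
    then have X: "X (q + i) \<in> f" "X (q + j) \<in> e" "X (q + k) \<in> f"
      using mem by (simp_all add: next_end_pow_X)
    \<comment> \<open>The only other end of \<open>e\<close> met within a turn from \<open>q\<close>
      is end 0, which appears here as index \<open>p\<close>.\<close>
    have "q + j = p"
    proof (cases "q + j < p")
      case True
      then show ?thesis using e_lt[of "q + j"] X ijk by auto
    next
      case False
      then have "X (q + j - p) \<in> e" "q + j - p < p"
        using X_diff[of "q + j"] X q ijk \<open>k < p\<close> by auto
      then show ?thesis
        using e_lt[of "q + j - p"] False ijk \<open>k < p\<close> by linarith
    qed
    then have "X (q + k - p) \<in> f"
      using X X_diff[of "q + k"] ijk by simp
    moreover have "0 < q + k - p" "q + k - p < q" "q < q + i" "q + i < p"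
      using ijk \<open>q + j = p\<close> \<open>k < p\<close> by auto
    ultimately show ?thesis
      using X by blast
  next
    case 3
    then have X: "X (p - i) \<in> f" "X (p - j) \<in> e" "X (p - k) \<in> f"
      using mem \<open>k < p\<close> ijk Y_mem_edge f(1) e(2) by (simp_all add: next_end_pow_Y)
    have "p - j = q"
      using e_lt[of "p - j"] X ijk \<open>k < p\<close> by auto
    then have "0 < p - k" "p - k < q" "q < p - i" "p - i < p"
      using ijk \<open>k < p\<close> by auto
    then show ?thesis
      using X by blast
  next
    case 4
    then have X: "X (q + p - i) \<in> f" "X (q + p - j) \<in> e" "X (q + p - k) \<in> f"
      using mem \<open>k < p\<close> ijk Y_mem_edge f(1) e(2) by (simp_all add: next_end_pow_Y)
    have "j = q"
    proof (cases "q + p - j < p")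
      case True
      then show ?thesis using e_lt[of "q + p - j"] X ijk \<open>k < p\<close> by auto
    next
      case False
      then have "X (q - j) \<in> e" "q - j < p" "j \<le> q"
        using X_diff[of "q + p - j"] X q ijk \<open>k < p\<close> by auto
      then show ?thesis
        using e_lt[of "q - j"] ijk by linarith
    qed
    then have "X (q - i) \<in> f"
      using X X_diff[of "q + p - i"] ijk by simp
    moreover have "0 < q - i" "q - i < q" "q < q + p - k" "q + p - k < p"
      using ijk \<open>j = q\<close> \<open>k < p\<close> by auto
    ultimately show ?thesis
      using X by blast
  qed
qed

text \<open>Let the ribbon at the root have its other end at \<open>q\<close>. Each of the other
  \<open>n - 1\<close> ribbons has exactly one end in each of the two arcs between 0 and
  \<open>q\<close>, so both arcs contain \<open>n - 1\<close> ends.\<close>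

lemma antipodal_root:
  assumes "card (edges B) = n"
    and complete: "\<And>e f. e \<in> edges B \<Longrightarrow> f \<in> edges B \<Longrightarrow> e \<noteq> f \<Longrightarrow> interlaced B e f"
  shows "p = 2 * n" "side B x0 = X n \<or> side B x0 = Y n"
proof -
  have "side B x0 \<in> range X \<union> range Y"
    using root by (simp flip: flags_eq)
  then obtain d where "side B x0 = X d \<or> side B x0 = Y d"
    by blast
  moreover define q where "q = d mod p"
  moreover have "X q = X d" "Y q = Y d"
    by (simp_all add: q_def X_mod Y_eq_X_iff)
  ultimately have side_q: "side B x0 = X q \<or> side B x0 = Y q"
    by simp
  have "q < p"
    using p_pos by (simp add: q_def)
  have "0 < q"
  proof (rule ccontr)
    assume "\<not> 0 < q"
    then have "side B x0 = x0 \<or> side B x0 = foot B x0"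
      using side_q by (simp add: Y_def X_0)
    then show False
      using root foot_ne_side[of x0] side(2)[of x0] by auto
  qed
  define e where "e = edge_of B x0"
  have e: "e = {X 0, Y 0, X q, Y q}"
    using side_q by (auto simp: e_def edge_of_def X_0 Y_def root)
  have "e \<in> edges B"
    using root by (simp add: e_def edges_eq)
  have inner: "f \<in> edges B - {e} \<Longrightarrow>
      \<exists>a b. 0 < a \<and> a < q \<and> q < b \<and> b < p \<and> X a \<in> f \<and> X b \<in> f" for f
    using crossing[OF \<open>0 < q\<close> \<open>q < p\<close> e \<open>e \<in> edges B\<close>, of f] complete[of e f] \<open>e \<in> edges B\<close> by auto
  have mem_e: "m = 0 \<or> m = q" if "X m \<in> e" "m < p" for m
    using that \<open>q < p\<close> X_ne_Y by (auto simp: e X_eq_iff)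
  have edge_X: "edge_of B (X m) \<in> edges B - {e}" "X m \<in> edge_of B (X m)"
    if "m < p" "m \<noteq> 0" "m \<noteq> q" for m
    using mem_e[of m] that by (auto simp: edges_eq edge_of_def)
  \<comment> \<open>Sending the ends in an arc \<open>I\<close> to their ribbons is injective: two
    ends in \<open>I\<close> and one outside would give a ribbon three ends.\<close>
  have count: "card I = n - 1"
    if I: "I \<subseteq> {m. m < p \<and> m \<noteq> 0 \<and> m \<noteq> q}"
      and meet: "\<And>f. f \<in> edges B - {e} \<Longrightarrow> \<exists>a\<in>I. X a \<in> f"
      and leave: "\<And>f. f \<in> edges B - {e} \<Longrightarrow> \<exists>b<p. b \<notin> I \<and> X b \<in> f"
    for I
  proof -
    have "inj_on (\<lambda>m. edge_of B (X m)) I"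
    proof (rule inj_onI)
      fix a c assume ac: "a \<in> I" "c \<in> I" "edge_of B (X a) = edge_of B (X c)"
      then have f: "edge_of B (X a) \<in> edges B - {e}" "X a \<in> edge_of B (X a)" "X c \<in> edge_of B (X a)"
        using I edge_X[of a] edge_X[of c] by auto
      obtain b where b: "b < p" "b \<notin> I" "X b \<in> edge_of B (X a)"
        using leave[OF f(1)] by blast
      moreover have "a < p" "c < p"
        using ac I by auto
      ultimately have "X b \<noteq> X a" "X b \<noteq> X c"
        using ac by (auto simp: X_eq_iff)
      then have "X a = X c"
        using edge_at_most_two[of "edge_of B (X a)" b a c] f b by blast
      then show "a = c"
        using \<open>a < p\<close> \<open>c < p\<close> by (simp add: X_eq_iff)
    qed
    moreover have "(\<lambda>m. edge_of B (X m)) ` I = edges B - {e}"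
    proof (intro equalityI subsetI)
      fix f assume f: "f \<in> edges B - {e}"
      then obtain a where "a \<in> I" "X a \<in> f"
        using meet by blast
      then show "f \<in> (\<lambda>m. edge_of B (X m)) ` I"
        using edge_eqI(1)[of f "X a"] f by blast
    qed (use I edge_X in auto)
    ultimately have "card I = card (edges B - {e})"
      by (metis card_image)
    then show ?thesis
      using \<open>e \<in> edges B\<close> assms(1) by simp
  qed
  have "card {0<..<q} = n - 1"
  proof (rule count)
    show "{0<..<q} \<subseteq> {m. m < p \<and> m \<noteq> 0 \<and> m \<noteq> q}"
      using \<open>q < p\<close> by auto
    show "\<exists>a\<in>{0<..<q}. X a \<in> f" "\<exists>b<p. b \<notin> {0<..<q} \<and> X b \<in> f"
      if "f \<in> edges B - {e}" for f
      using inner[OF that] by force+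
  qed
  moreover have "card {q<..<p} = n - 1"
  proof (rule count)
    show "{q<..<p} \<subseteq> {m. m < p \<and> m \<noteq> 0 \<and> m \<noteq> q}"
      by auto
    show "\<exists>a\<in>{q<..<p}. X a \<in> f" "\<exists>b<p. b \<notin> {q<..<p} \<and> X b \<in> f"
      if "f \<in> edges B - {e}" for f
      using inner[OF that] by (force, metis greaterThanLessThan_iff less_asym less_trans)
  qed
  moreover have "n \<noteq> 0"
  proof -
    have "finite (edges B)"
      using finite_flags by (simp add: edges_eq)
    then show ?thesis
      using \<open>e \<in> edges B\<close> assms(1) by (metis card_0_eq empty_iff)
  qed
  ultimately have "q = n" "p = 2 * n"
    using \<open>0 < q\<close> \<open>q < p\<close> by auto
  then show "p = 2 * n" "side B x0 = X n \<or> side B x0 = Y n"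
    using side_q by auto
qed

text \<open>\<open>antipodal_root\<close> describes only the ribbon at the root, so the bouquet is
  rooted afresh at every \<open>X m\<close>.\<close>

lemma antipodal_if_complete:
  assumes "card (edges B) = n" "n > 0"
    and complete: "\<And>e f. e \<in> edges B \<Longrightarrow> f \<in> edges B \<Longrightarrow> e \<noteq> f \<Longrightarrow> interlaced B e f"
  shows "antipodal B n X Y (\<lambda>m. side B (X m) = X (m + n))"
proof -
  have p_eq: "p = 2 * n"
    using antipodal_root assms by blast
  have side_cases: "side B (X m) = X (m + n) \<or> side B (X m) = Y (m + n)" for m
  proof -
    interpret R: rooted_bouquet B "X m"
      by unfold_locales (simp_all add: bouquet)
    have "R.X n = X (m + n)"
      using next_end_pow_X by (simp add: R.X_def)
    then show ?thesis
      using R.antipodal_root(2)[of n] assms by (simp add: R.Y_def Y_def)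
  qed
  have side_X: "side B (X m) = (if side B (X m) = X (m + n) then X (m + n) else Y (m + n))" for m
    using side_cases[of m] by auto
  have side_Y: "side B (Y m) = (if side B (X m) = X (m + n) then Y (m + n) else X (m + n))" for m
    using side_cases[of m] by (auto simp: Y_def side_foot)
  have X_add: "X (m + n + n) = X m" for m
    using X_add_p[of m] by (simp add: p_eq mult_2 add.assoc)
  \<comment> \<open>Both ends agree on the twist because \<open>side\<close> is an involution; in
    the untwisted case, commuting it with \<open>foot\<close> passes from \<open>Y (m + n)\<close>
    to \<open>X (m + n)\<close>.\<close>
  have twist: "side B (X (m + n)) = X (m + n + n) \<longleftrightarrow> side B (X m) = X (m + n)" for m
  proof (cases "side B (X m) = X (m + n)")
    case True
    then show ?thesis
      using side(3)[OF X_in[of m]] by (simp add: X_add)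
  next
    case False
    then have "side B (Y (m + n)) = X m"
      using side_cases[of m] side(3)[OF X_in[of m]] by metis
    then have "side B (X (m + n)) = Y m"
      using side_foot[of "Y (m + n)"] by (simp add: foot_Y Y_def)
    then show ?thesis
      using False not_sym[OF X_ne_Y] by (simp add: X_add)
  qed
  show ?thesis
  proof
    show "flags B = range X \<union> range Y" by (rule flags_eq)
    show "isolated B = 0" using orbit_vertex by simp
    show "foot B (X m) = Y m" for m by (simp add: Y_def)
    show "gap B (Y m) = X (Suc m)" for m by (simp add: X_Suc)
  qed (fact assms(2) X_eq_iff[unfolded p_eq] X_ne_Y foot_Y gap_X_Suc side_X side_Y twist
      Y_eq_X_iff[unfolded X_eq_iff p_eq])+
qed

end

section \<open>The polynomial of complete graphs\<close>

text \<open>Completeness supplies an arc between the images of \<open>e\<close> and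
  \<open>f\<close>. It comes from an arc of the intersection graph, whose ends are \<open>e\<close>
  and \<open>f\<close> by injectivity on vertices.\<close>

lemma complete_if_digraph_iso:
  assumes "digraph_iso (with_proj (intersection_graph B)) G" "K\<^bsub>n\<^esub> G"
  shows "card (edges B) = n"
    and "\<And>e f. e \<in> edges B \<Longrightarrow> f \<in> edges B \<Longrightarrow> e \<noteq> f \<Longrightarrow> interlaced B e f"
proof -
  let ?I = "with_proj (intersection_graph B)"
  obtain h where h: "pre_digraph.digraph_isomorphism ?I h" and G: "G = app_iso h ?I"
    using assms(1) by (auto simp: digraph_iso_def)
  have inj: "inj_on (iso_verts h) (edges B)"
    using h by (simp add: pre_digraph.digraph_isomorphism_def intersection_graph_def)
  have verts: "verts G = iso_verts h ` edges B"
    using G by (simp add: intersection_graph_def)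
  show "card (edges B) = n"
    using assms(2) inj by (simp add: complete_digraph_def verts card_image)
  fix e f assume ef: "e \<in> edges B" "f \<in> edges B" "e \<noteq> f"
  then have "(iso_verts h e, iso_verts h f) \<in> arcs_ends G"
    using assms(2) inj_onD[OF inj] by (auto simp: complete_digraph_def verts)
  then obtain a where a: "a \<in> parcs (intersection_graph B)"
    "iso_verts h e = iso_tail h (iso_arcs h a)" "iso_verts h f = iso_head h (iso_arcs h a)"
    using G by (auto simp: arcs_ends_def arc_to_ends_def)
  then have "iso_verts h e = iso_verts h (fst a)" "iso_verts h f = iso_verts h (snd a)"
    using h by (simp_all add: pre_digraph.digraph_isomorphism_def)
  moreover have "fst a \<in> edges B" "snd a \<in> edges B" "interlaced B (fst a) (snd a)"
    using a(1) by (auto simp: intersection_graph_def)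
  ultimately show "interlaced B e f"
    using inj_onD[OF inj] ef by metis
qed

text \<open>Any bijection of the vertices will do. As \<open>G\<close> has no parallel arcs, its
  arcs correspond to ordered pairs of distinct vertices, and the induced bijection of pairs is
  carried back along \<open>arc_to_ends\<close>.\<close>

lemma (in antipodal) digraph_iso_complete:
  assumes "K\<^bsub>n\<^esub> G"
  shows "digraph_iso (with_proj (intersection_graph B)) G"
proof -
  let ?I = "with_proj (intersection_graph B)"
  interpret G: graph G
    using assms by (simp add: complete_digraph_def)
  have "\<not> interlaced B e e" for e
    by (simp add: interlaced_def)
  then have arcs_I: "arcs ?I = {(e, f). e \<in> edges B \<and> f \<in> edges B \<and> e \<noteq> f}"
    using interlaced_edges unfolding intersection_graph_def by auto
  have "finite (edges B)" "card (edges B) = card (verts G)"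
    using assms card_edges by (simp_all add: edges_eq_image complete_digraph_def)
  then obtain h where h: "bij_betw h (edges B) (verts G)"
    using finite_same_card_bij[of "edges B" "verts G"] by auto
  have ends: "arc_to_ends G ` arcs G = {(u, v). u \<in> verts G \<and> v \<in> verts G \<and> u \<noteq> v}"
    using assms by (auto simp: complete_digraph_def arcs_ends_def)
  have bij_ends: "bij_betw (arc_to_ends G) (arcs G) {(u, v). u \<in> verts G \<and> v \<in> verts G \<and> u \<noteq> v}"
    using G.inj_on_arc_to_ends ends by (simp add: bij_betw_def)
  have bij_pairs: "bij_betw (map_prod h h) (arcs ?I) {(u, v). u \<in> verts G \<and> v \<in> verts G \<and> u \<noteq> v}"
    unfolding bij_betw_def
  proof
    have inj: "inj_on h (edges B)" and verts: "verts G = h ` edges B"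
      using h by (simp_all add: bij_betw_def)
    show "inj_on (map_prod h h) (arcs ?I)"
      unfolding arcs_I by (rule inj_on_subset[OF map_prod_inj_on[OF inj inj]]) auto
    show "map_prod h h ` arcs ?I = {(u, v). u \<in> verts G \<and> v \<in> verts G \<and> u \<noteq> v}"
      unfolding arcs_I verts using inj_onD[OF inj] by (auto simp: image_iff)
  qed
  define k where "k = inv_into (arcs G) (arc_to_ends G) \<circ> map_prod h h"
  have bij_k: "bij_betw k (arcs ?I) (arcs G)"
    unfolding k_def by (rule bij_betw_trans[OF bij_pairs bij_betw_inv_into[OF bij_ends]])
  have ends_k: "arc_to_ends G (k a) = map_prod h h a" if "a \<in> arcs ?I" for a
    using bij_betw_inv_into_right[OF bij_ends] bij_betwE[OF bij_pairs] that by (simp add: k_def)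
  \<comment> \<open>\<open>app_iso\<close> takes head and tail from the isomorphism, so they must be
    those of \<open>G\<close> for the image to equal \<open>G\<close>.\<close>
  define iso where "iso = \<lparr>iso_verts = h, iso_arcs = k, iso_head = head G, iso_tail = tail G\<rparr>"
  have verts_I: "verts ?I = edges B"
    by (simp add: intersection_graph_def)
  have "wf_digraph ?I"
    by unfold_locales (auto simp: intersection_graph_def)
  moreover have "h (tail ?I a) = tail G (k a) \<and> h (head ?I a) = head G (k a)" if "a \<in> arcs ?I" for a
    using ends_k[OF that] by (cases a) (simp add: arc_to_ends_def)
  ultimately have "pre_digraph.digraph_isomorphism ?I iso"
    using h bij_k
    by (simp add: pre_digraph.digraph_isomorphism_def iso_def bij_betw_def verts_I del: with_proj_simps)
  moreover have "G = app_iso iso ?I"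
    using h bij_k
    by (intro pre_digraph.equality) (simp_all add: iso_def bij_betw_def verts_I del: with_proj_simps)
  ultimately show ?thesis
    unfolding digraph_iso_def by blast
qed

text \<open>End \<open>m\<close> has the corners \<open>2 * m\<close> and \<open>2 * m + 1\<close>.
  Adding \<open>2 * n\<close> preserves parity, so making all ribbons twisted turns
  \<open>side\<close> into a mere shift. On even numbers \<open>gap\<close> subtracts 1, written as
  adding \<open>4 * n - 1\<close>.\<close>

definition antipodal_model :: "nat \<Rightarrow> nat ribbon_graph" where
  "antipodal_model n = \<lparr>flags = {..<4 * n},
     foot = (\<lambda>z. if even z then z + 1 else z - 1),
     side = (\<lambda>z. (z + 2 * n) mod (4 * n)),
     gap = (\<lambda>z. if even z then (z + (4 * n - 1)) mod (4 * n) else (z + 1) mod (4 * n)),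
     isolated = 0\<rparr>"

lemma antipodal_model:
  assumes "n > 0"
  shows "antipodal (antipodal_model n) n
    (\<lambda>m. 2 * m mod (4 * n)) (\<lambda>m. (2 * m + 1) mod (4 * n)) (\<lambda>_. True)"
proof -
  have mod4: "2 * m mod (4 * n) = 2 * (m mod (2 * n))" for m
    using mult_mod_right[of 2 m "2 * n"] by simp
  have mod4': "(2 * m + 1) mod (4 * n) = 2 * (m mod (2 * n)) + 1" for m
  proof -
    have "2 * (m mod (2 * n)) + 1 < 4 * n"
      using mod_less_divisor[of "2 * n" m] assms by linarith
    then show ?thesis
      using mod_add_left_eq[of "2 * m" "4 * n" 1] by (simp add: mod4)
  qed
  have even: "even (2 * m mod (4 * n))" and odd: "odd ((2 * m + 1) mod (4 * n))" for m
    unfolding mod4 mod4' by simp_all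
  show ?thesis
  proof
    show "flags (antipodal_model n) =
        range (\<lambda>m. 2 * m mod (4 * n)) \<union> range (\<lambda>m. (2 * m + 1) mod (4 * n))"
    proof (intro equalityI subsetI)
      fix z assume "z \<in> flags (antipodal_model n)"
      then have "z mod (4 * n) = z"
        by (simp add: antipodal_model_def)
      then have "z = 2 * (z div 2) mod (4 * n) \<or> z = (2 * (z div 2) + 1) mod (4 * n)"
        by (cases "even z") simp_all
      then show "z \<in> range (\<lambda>m. 2 * m mod (4 * n)) \<union> range (\<lambda>m. (2 * m + 1) mod (4 * n))"
        by blast
    qed (use assms in \<open>auto simp: antipodal_model_def\<close>)
    show "gap (antipodal_model n) (2 * Suc m mod (4 * n)) = (2 * m + 1) mod (4 * n)" for m
    proof -
      have "(2 * Suc m mod (4 * n) + (4 * n - 1)) mod (4 * n) = (2 * Suc m + (4 * n - 1)) mod (4 * n)"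
        by (rule mod_add_left_eq)
      also have "2 * Suc m + (4 * n - 1) = 2 * m + 1 + 4 * n"
        using assms by simp
      also have "(2 * m + 1 + 4 * n) mod (4 * n) = (2 * m + 1) mod (4 * n)"
        by (rule mod_add_self2)
      finally show ?thesis
        using even[of "Suc m"] unfolding antipodal_model_def by (simp del: mult_Suc_right)
    qed
    show "side (antipodal_model n) (2 * m mod (4 * n)) =
        (if True then 2 * (m + n) mod (4 * n) else (2 * (m + n) + 1) mod (4 * n))" for m
      by (simp add: antipodal_model_def mod_add_left_eq)
    show "side (antipodal_model n) ((2 * m + 1) mod (4 * n)) =
        (if True then (2 * (m + n) + 1) mod (4 * n) else 2 * (m + n) mod (4 * n))" for m
      using mod_add_left_eq[of "2 * m + 1" "4 * n" "2 * n"]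
      by (simp add: antipodal_model_def add.assoc add.commute[of 1])
    show "gap (antipodal_model n) ((2 * m + 1) mod (4 * n)) = 2 * Suc m mod (4 * n)" for m
    proof -
      have "((2 * m + 1) mod (4 * n) + 1) mod (4 * n) = (2 * m + 1 + 1) mod (4 * n)"
        by (rule mod_add_left_eq)
      then show ?thesis
        using odd[of m] unfolding antipodal_model_def by simp
    qed
    show "2 * a mod (4 * n) \<noteq> (2 * b + 1) mod (4 * n)" for a b
      using even[of a] odd[of b] by metis
    show "foot (antipodal_model n) (2 * m mod (4 * n)) = (2 * m + 1) mod (4 * n)"
      "foot (antipodal_model n) ((2 * m + 1) mod (4 * n)) = 2 * m mod (4 * n)" for m
      unfolding mod4 mod4' by (simp_all add: antipodal_model_def)
    show "2 * a mod (4 * n) = 2 * b mod (4 * n) \<longleftrightarrow> a mod (2 * n) = b mod (2 * n)"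
      "(2 * a + 1) mod (4 * n) = (2 * b + 1) mod (4 * n) \<longleftrightarrow> a mod (2 * n) = b mod (2 * n)" for a b
      unfolding mod4 mod4' by simp_all
  qed (simp_all add: assms antipodal_model_def)
qed

theorem theorem3p9:
  fixes G :: "('a, 'b) pre_digraph" and n :: nat
  assumes "n \<ge> 2" and "K\<^bsub>n\<^esub> G"
  shows "circle_graph_petrial_poly G =
    (if even n
     then monom 1 n + (\<Sum>i=1..n. monom (of_nat (n choose (n + 1 - i))) i)
     else monom 1 (n - 1) + (\<Sum>i=1..n. monom (of_nat (n choose (n + 1 - i))) i))"
    (is "_ = ?P")
proof -
  \<comment> \<open>Every bouquet with this intersection graph is antipodal, whatever its twists,
    and so has the same polynomial.\<close>
  have poly: "petrial_poly B = ?P"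
    if "bouquet B" "digraph_iso (with_proj (intersection_graph B)) G" for B :: "nat ribbon_graph"
  proof -
    have card: "card (edges B) = n"
      using complete_if_digraph_iso(1)[OF that(2) assms(2)] .
    \<comment> \<open>The numbering needs a root; a bouquet without flags would have no
      edges.\<close>
    have "flags B \<noteq> {}"
    proof
      assume "flags B = {}"
      then have "edges B = {}"
        by (simp add: edges_def orbits_def quotient_def)
      then show False
        using card assms(1) by simp
    qed
    then obtain x where "x \<in> flags B"
      by blast
    then interpret rooted_bouquet B x
      by unfold_locales (rule that(1))
    interpret antipodal B n X Y "\<lambda>m. side B (X m) = X (m + n)"
      using antipodal_if_complete[OF card] complete_if_digraph_iso(2)[OF that(2) assms(2)] assms(1)
      by simp
    show ?thesis
      by (rule petrial_poly_formula)
  qed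
  \<comment> \<open>The model shows that a bouquet as required by the definite description exists,
    and it forces any rival value \<open>r\<close> to be the stated one.\<close>
  interpret M: antipodal "antipodal_model n" n "\<lambda>m. 2 * m mod (4 * n)"
    "\<lambda>m. (2 * m + 1) mod (4 * n)" "\<lambda>_. True"
    using assms(1) by (intro antipodal_model) simp
  have model: "bouquet (antipodal_model n)"
    "digraph_iso (with_proj (intersection_graph (antipodal_model n))) G"
    using M.bouquet M.digraph_iso_complete[OF assms(2)] by simp_all
  show ?thesis
    unfolding circle_graph_petrial_poly_def
  proof (rule the_equality)
    let ?Q = "\<lambda>B :: nat ribbon_graph.
      bouquet B \<and> digraph_iso (with_proj (intersection_graph B)) G"
    have Q: "?Q (antipodal_model n)"
      using model by blast
    then show "(\<exists>B. ?Q B) \<and> (\<forall>B. ?Q B \<longrightarrow> petrial_poly B = ?P)"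
      using poly by blast
    fix r assume r: "(\<exists>B. ?Q B) \<and> (\<forall>B. ?Q B \<longrightarrow> petrial_poly B = r)"
    have "petrial_poly (antipodal_model n) = r"
      using conjunct2[OF r] Q by blast
    from trans[OF sym[OF this] poly[OF model]] show "r = ?P" .
  qed
qed

end
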